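(* Let $C \in \mathbb{R}^{m\times k}$ and $R\in\mathbb{R}^{k\times n}$ be real matrices and let $A = CR \in \mathbb{R}^{m\times n}$. Let $P\in\mathbb{R}^{m\times p}$ and $Q\in\mathbb{R}^{n\times q}$. Then $$A^+ = (P^TCR)^+\,P^TCRQ\,(CRQ)^+$$ if and only if $P$ and $Q$ satisfy $$\mathrm{rank}(P^TA) = \mathrm{rank}(AQ) = \mathrm{rank}(A).$$
   Context: All matrices are real. For a matrix $M$, $M^+$ denotes its Moore–Penrose pseudoinverse, i.e. the unique matrix with $MM^+M=M$, $M^+MM^+=M^+$, $(M^+M)^T=M^+M$, $(MM^+)^T=MM^+$. *)

theory Defs
  imports "HOL-Analysis.Analysis"
begin

definition is_moore_penrose :: "real^'n^'m \<Rightarrow> real^'m^'n \<Rightarrow> bool" where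
  "is_moore_penrose M X \<longleftrightarrow>
     M ** X ** M = M \<and> X ** M ** X = X \<and>
     transpose (X ** M) = X ** M \<and> transpose (M ** X) = M ** X"

definition pseudoinverse :: "real^'n^'m \<Rightarrow> real^'m^'n" where
  "pseudoinverse M = (THE X. is_moore_penrose M X)"

lemma is_moore_penrose_unique:
  assumes "is_moore_penrose M X" "is_moore_penrose M Y"
  shows "X = Y"
proof -
  have *: "M ** X = M ** Y"
  proof -
    have "M ** X = transpose (M ** Y ** (M ** X))"
      using assms by (metis is_moore_penrose_def matrix_mul_assoc)
    also have "\<dots> = transpose (M ** X) ** transpose (M ** Y)"
      by (rule matrix_transpose_mul)
    also have "\<dots> = M ** X ** M ** Y"
      using assms by (metis is_moore_penrose_def matrix_mul_assoc)
    finally show ?thesis using assms by (simp add: is_moore_penrose_def)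
  qed
  have **: "X ** M = Y ** M"
  proof -
    have "X ** M = transpose (X ** M ** (Y ** M))"
      using assms by (metis is_moore_penrose_def matrix_mul_assoc)
    also have "\<dots> = transpose (Y ** M) ** transpose (X ** M)"
      by (rule matrix_transpose_mul)
    also have "\<dots> = Y ** (M ** X ** M)"
      using assms by (metis is_moore_penrose_def matrix_mul_assoc)
    finally show ?thesis using assms by (simp add: is_moore_penrose_def)
  qed
  have "X = X ** (M ** X)" using assms by (simp add: is_moore_penrose_def matrix_mul_assoc)
  also have "\<dots> = Y ** M ** Y" by (simp add: * ** matrix_mul_assoc)
  finally show ?thesis using assms by (simp add: is_moore_penrose_def)
qed

lemma exists_inner_inverse:
  fixes M :: "real^'n^'m"
  shows "\<exists>G :: real^'m^'n. M ** G ** M = M"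
proof -
  obtain g where g: "linear g" "\<forall>v\<in>range ((*v) M). M *v g v = v"
    using linear_exists_right_inverse_on[OF matrix_vector_mul_linear[of M] subspace_UNIV] by auto
  have "M ** matrix g ** M = M"
    using g by (simp add: matrix_eq matrix_works matrix_vector_mul_assoc[symmetric])
  then show ?thesis by blast
qed

lemma transpose_mult_self_eq_0D:
  fixes H :: "real^'n^'m"
  assumes "transpose H ** H = 0"
  shows "H = 0"
proof -
  have "H *v x = 0" for x
  proof -
    have "(H *v x) \<bullet> (H *v x) = x \<bullet> ((transpose H ** H) *v x)"
      by (metis dot_lmul_matrix inner_commute matrix_vector_mul_assoc transpose_matrix_vector)
    then show ?thesis using assms by simp
  qed
  then show ?thesis by (simp add: matrix_eq)
qed

lemma matrix_sub_ldistrib':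
  fixes A :: "real^'n^'m"
  shows "A ** (X - Y) = A ** X - A ** Y"
  by (simp add: matrix_eq matrix_vector_mul_assoc[symmetric] matrix_vector_mult_diff_rdistrib
      matrix_vector_mult_diff_distrib)

lemma transpose_mult_cancel_left:
  fixes A :: "real^'n^'m"
  assumes "transpose A ** (A ** X) = transpose A ** (A ** Y)"
  shows "A ** X = A ** Y"
proof -
  let ?D = "X - Y"
  have "transpose A ** (A ** ?D) = 0"
    using assms by (simp add: matrix_sub_ldistrib')
  then have "transpose (A ** ?D) ** (A ** ?D) = 0"
    by (simp add: matrix_transpose_mul matrix_mul_assoc[symmetric])
  then have "A ** ?D = 0" by (rule transpose_mult_self_eq_0D)
  then show ?thesis by (simp add: matrix_sub_ldistrib')
qed

lemma exists_symmetric_projection: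
  fixes A :: "real^'n^'m"
  obtains G where "A ** G ** transpose A ** A = A"
    "transpose (A ** G ** transpose A) = A ** G ** transpose A"
proof -
  obtain G where "(transpose A ** A) ** G ** (transpose A ** A) = transpose A ** A"
    using exists_inner_inverse by blast
  then have "transpose A ** (A ** (G ** transpose A ** A)) = transpose A ** (A ** mat 1)"
    by (simp add: matrix_mul_assoc)
  then have 1: "A ** G ** transpose A ** A = A"
    using transpose_mult_cancel_left[of A "G ** transpose A ** A" "mat 1"]
    by (simp add: matrix_mul_assoc)
  let ?P = "A ** G ** transpose A"
  have "transpose A = transpose A ** transpose ?P"
    by (metis 1 matrix_transpose_mul)
  then have "?P = ?P ** transpose ?P"
    by (metis matrix_mul_assoc)
  then have "transpose ?P = ?P"
    by (metis matrix_transpose_mul transpose_transpose)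
  with 1 that show ?thesis by blast
qed

lemma ex1_moore_penrose:
  fixes A :: "real^'n^'m"
  shows "\<exists>!X. is_moore_penrose A X"
proof -
  obtain G where G: "A ** G ** transpose A ** A = A"
    "transpose (A ** G ** transpose A) = A ** G ** transpose A"
    by (rule exists_symmetric_projection)
  obtain H where H: "transpose A ** H ** A ** transpose A = transpose A"
    "transpose (transpose A ** H ** A) = transpose A ** H ** A"
    using exists_symmetric_projection[of "transpose A"] by (auto simp: transpose_transpose)
  have H': "A ** transpose A ** H ** A = A"
    by (metis H matrix_transpose_mul transpose_transpose matrix_mul_assoc)
  define X where "X = transpose A ** H ** A ** G ** transpose A"
  have AX: "A ** X = A ** G ** transpose A"
    unfolding X_def by (simp add: matrix_mul_assoc H')
  have XA: "X ** A = transpose A ** H ** A"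
    unfolding X_def by (metis G(1) matrix_mul_assoc)
  have XAX: "X ** A ** X = X"
    unfolding XA unfolding X_def by (simp add: matrix_mul_assoc H)
  have "is_moore_penrose A X"
    using G H AX XA XAX by (simp add: is_moore_penrose_def)
  then show ?thesis using is_moore_penrose_unique by blast
qed

lemma is_moore_penrose_pseudoinverse: "is_moore_penrose M (pseudoinverse M)"
  unfolding pseudoinverse_def by (rule theI'[OF ex1_moore_penrose])

end

theory Submission
  imports Defs
begin

text \<open>If $AQ$ and $P^TA$ have the rank of $A$, then $A$ and $AQ$ have the same column space and
  $A$ and $P^TA$ the same row space, so $AQ(AQ)^+ = AA^+$ and $(P^TA)^+P^TA = A^+A$, and the product
  telescopes to $A^+AA^+ = A^+$. Conversely, inserting the formula in $A = AA^+A$ displays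
  $A$ as a product with factor $P^TA$ and as a product with factor $AQ$.\<close>

lemma mult_pseudoinverse_mult [simp]: "M ** pseudoinverse M ** M = M"
  using is_moore_penrose_pseudoinverse[of M] by (simp add: is_moore_penrose_def)

lemma pseudoinverse_mult_pseudoinverse [simp]:
  "pseudoinverse M ** M ** pseudoinverse M = pseudoinverse M"
  using is_moore_penrose_pseudoinverse[of M] by (simp add: is_moore_penrose_def)

lemma transpose_pseudoinverse_mult [simp]:
  "transpose (pseudoinverse M ** M) = pseudoinverse M ** M"
  using is_moore_penrose_pseudoinverse[of M] by (simp add: is_moore_penrose_def)

lemma transpose_mult_pseudoinverse [simp]:
  "transpose (M ** pseudoinverse M) = M ** pseudoinverse M"
  using is_moore_penrose_pseudoinverse[of M] by (simp add: is_moore_penrose_def)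

text \<open>The column space of \<open>M ** N\<close> lies in that of \<open>M\<close>, so equal
  dimensions force equality. An inner inverse \<open>G\<close> of \<open>M ** N\<close> then yields
  \<open>W = G ** M\<close>.\<close>

lemma rank_mult_eq_leftD:
  fixes M :: "real^'n^'m" and N :: "real^'k^'n"
  assumes "rank (M ** N) = rank M"
  obtains W where "M ** N ** W = M"
proof -
  have sub: "range ((*v) (M ** N)) \<subseteq> range ((*v) M)"
    by (auto simp: matrix_vector_mul_assoc[symmetric])
  have range_eq: "range ((*v) (M ** N)) = range ((*v) M)"
  proof (rule subspace_dim_equal)
    show "dim (range ((*v) M)) \<le> dim (range ((*v) (M ** N)))"
      using assms by (simp add: rank_dim_range)
  qed (use sub in \<open>auto intro: linear_subspace_image\<close>)
  obtain G where G: "(M ** N) ** G ** (M ** N) = M ** N"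
    using exists_inner_inverse by blast
  have "(M ** N ** (G ** M)) *v x = M *v x" for x
  proof -
    obtain y where y: "M *v x = (M ** N) *v y"
      using range_eq by blast
    \<comment> \<open>\<open>M ** N ** G\<close> fixes every vector in the column space of
      \<open>M ** N\<close>, hence also \<open>M *v x\<close>.\<close>
    have "(M ** N ** (G ** M)) *v x = (M ** N ** G) *v (M *v x)"
      by (simp add: matrix_vector_mul_assoc matrix_mul_assoc)
    also have "\<dots> = M *v x"
      by (simp add: y matrix_vector_mul_assoc G)
    finally show ?thesis .
  qed
  then have "M ** N ** (G ** M) = M"
    by (simp add: matrix_eq)
  then show thesis by (rule that)
qed

text \<open>Both sides are orthogonal projections, and equal rank gives them the same range. Each
  fixes the columns of the other, and symmetry makes them coincide.\<close>

lemma mult_pseudoinverse_eq_if_rank_eq: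
  fixes M :: "real^'n^'m" and N :: "real^'k^'n"
  assumes "rank (M ** N) = rank M"
  shows "M ** N ** pseudoinverse (M ** N) = M ** pseudoinverse M"
proof -
  let ?E = "M ** N ** pseudoinverse (M ** N)" and ?F = "M ** pseudoinverse M"
  obtain W where W: "M ** N ** W = M"
    using assms by (rule rank_mult_eq_leftD)
  have "?E ** ?F = ?E ** (M ** N ** W) ** pseudoinverse M"
    by (simp add: W matrix_mul_assoc)
  also have "\<dots> = (?E ** (M ** N)) ** W ** pseudoinverse M"
    by (simp only: matrix_mul_assoc)
  also have "\<dots> = ?F"
    by (simp only: mult_pseudoinverse_mult W)
  finally have "?E ** ?F = ?F" .
  \<comment> \<open>Transposing reverses the product, and both factors are symmetric.\<close>
  then have "?F ** ?E = ?F"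
    by (metis matrix_transpose_mul transpose_mult_pseudoinverse)
  moreover have "?F ** ?E = ?E"
    by (simp add: matrix_mul_assoc)
  ultimately show ?thesis by simp
qed

text \<open>Transposition preserves the first two Penrose equations and swaps the two symmetry
  conditions; uniqueness does the rest.\<close>

lemma pseudoinverse_transpose:
  "pseudoinverse (transpose M) = transpose (pseudoinverse M)"
proof (rule is_moore_penrose_unique[OF is_moore_penrose_pseudoinverse])
  show "is_moore_penrose (transpose M) (transpose (pseudoinverse M))"
    unfolding is_moore_penrose_def
    by (simp only: matrix_transpose_mul[symmetric])
      (simp add: matrix_mul_assoc)
qed

text \<open>The row space counterpart, obtained by applying the column space version to the
  transposes.\<close>

lemma pseudoinverse_mult_eq_if_rank_eq:
  fixes M :: "real^'k^'n" and N :: "real^'n^'m"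
  assumes "rank (N ** M) = rank M"
  shows "pseudoinverse (N ** M) ** (N ** M) = pseudoinverse M ** M"
proof -
  have "rank (transpose M ** transpose N) = rank (transpose M)"
    using assms by (metis matrix_transpose_mul rank_transpose)
  from mult_pseudoinverse_eq_if_rank_eq[OF this]
  have "transpose (pseudoinverse (N ** M) ** (N ** M)) = transpose (pseudoinverse M ** M)"
    by (simp only: matrix_transpose_mul[symmetric] pseudoinverse_transpose)
  then show ?thesis by simp
qed

theorem theorem4:
  fixes C :: "real^'k^'m" and R :: "real^'n^'k" and A :: "real^'n^'m"
    and P :: "real^'p^'m" and Q :: "real^'q^'n"
  assumes "A = C ** R"
  shows "pseudoinverse A =
      pseudoinverse (transpose P ** C ** R) ** (transpose P ** C ** R ** Q)
        ** pseudoinverse (C ** R ** Q)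
    \<longleftrightarrow> rank (transpose P ** A) = rank (A ** Q) \<and> rank (A ** Q) = rank A"
proof -
  let ?B = "transpose P ** A" and ?D = "A ** Q"
  let ?X = "pseudoinverse ?B ** (?B ** Q) ** pseudoinverse ?D"
  have CR: "transpose P ** C ** R = ?B" "C ** R = A"
    using assms by (simp_all add: matrix_mul_assoc)
  have "pseudoinverse A = ?X \<longleftrightarrow> rank ?B = rank ?D \<and> rank ?D = rank A"
  proof
    assume eq: "pseudoinverse A = ?X"
    have A: "A = A ** ?X ** A"
      by (simp only: eq[symmetric] mult_pseudoinverse_mult)
    then have "A = (A ** pseudoinverse ?B) ** (?B ** (Q ** pseudoinverse ?D ** A))"
      by (simp only: matrix_mul_assoc)
    then have "rank A \<le> rank ?B"
      by (metis rank_mul_le_left rank_mul_le_right order_trans)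
    \<comment> \<open>Since \<open>?B ** Q = transpose P ** ?D\<close>, the same product can be
      regrouped around \<open>?D\<close>.\<close>
    moreover from A
    have "A = (A ** pseudoinverse ?B ** transpose P) ** (?D ** (pseudoinverse ?D ** A))"
      by (simp only: matrix_mul_assoc)
    then have "rank A \<le> rank ?D"
      by (metis rank_mul_le_left rank_mul_le_right order_trans)
    ultimately show "rank ?B = rank ?D \<and> rank ?D = rank A"
      using rank_mul_le_left[of A Q] rank_mul_le_right[of "transpose P" A] by linarith
  next
    assume "rank ?B = rank ?D \<and> rank ?D = rank A"
    then have B: "pseudoinverse ?B ** ?B = pseudoinverse A ** A"
      and D: "?D ** pseudoinverse ?D = A ** pseudoinverse A"
      by (simp_all add: pseudoinverse_mult_eq_if_rank_eq mult_pseudoinverse_eq_if_rank_eq)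
    have "?X = pseudoinverse ?B ** transpose P ** (?D ** pseudoinverse ?D)"
      by (simp only: matrix_mul_assoc)
    \<comment> \<open>The \<open>A\<close> in \<open>A ** pseudoinverse A\<close>, which replaces
      the projection of \<open>?D\<close>, joins \<open>transpose P\<close> to restore
      \<open>?B\<close>.\<close>
    also have "\<dots> = (pseudoinverse ?B ** ?B) ** pseudoinverse A"
      by (simp only: D matrix_mul_assoc)
    also have "\<dots> = pseudoinverse A"
      by (simp only: B pseudoinverse_mult_pseudoinverse)
    finally show "pseudoinverse A = ?X" ..
  qed
  then show ?thesis by (simp only: CR)
qed

end
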